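(* Let $X \subseteq \mathbb{Z}^{p_1}\times\mathbb{R}^{n_1-p_1}$ be nonempty and compact, and let $f_1,\dots,f_N:X\to\mathbb{R}$ satisfy the Complete Continuous Recourse assumption (see context). Let $v^*:=\min_{\bm{x}\in X}\sum_{i=1}^N f_i(\bm{x})$ and $g_i^*(\bm{x}):=\frac1N\sum_{j=1}^N f_j(\bm{x})-f_i(\bm{x})$. For each $i\in[N]$ let $\{\mathcal{L}_i(\hat{\bm{x}},\cdot):X\to\mathbb{R}\,:\,\hat{\bm{x}}\in X\}$ be a family of cuts that is - valid: $g_i^*(\bm{x})\ge\mathcal{L}_i(\hat{\bm{x}},\bm{x})$ for all $\bm{x},\hat{\bm{x}}\in X$; - tight: $g_i^*(\hat{\bm{x}})=\mathcal{L}_i(\hat{\bm{x}},\hat{\bm{x}})$ for all $\hat{\bm{x}}\in X$; - uniformly Lipschitz continuous: there is a constant $L_i\ge0$ with $|\mathcal{L}_i(\hat{\bm{x}},\bm{x})-\mathcal{L}_i(\hat{\bm{x}},\bm{y})|\le L_i\|\bm{x}-\bm{y}\|$ for all $\bm{x},\bm{y},\hat{\bm{x}}\in X$. Then the sequence of lower bounds $\{\mathit{lb}_t\}$ produced by the iterative GDD algorithm (see context) with the regularizers $$g_i(\mathcal{X}^t,\bm{x}):=\max_{k\in[K_t]}\mathcal{L}_i(\bm{x}_{(k)},\bm{x}),\qquad \mathcal{X}^t=\{\bm{x}_{(k)}:k\in[K_t]\},\ i\in[N],\ t\ge1,$$ converges to $v^*$.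
   Context: $[N]:=\{1,\dots,N\}$; $K_t=|\mathcal{X}^t|$. Iterative GDD algorithm (run without stopping). Initialize $\mathcal{X}^0=\emptyset$, $g_i(\mathcal{X}^0,\cdot)=0$ for all $i\in[N]$. In iteration $t=0,1,2,\dots$: for each $i\in[N]$, compute an optimal solution $\bm{x}^i_t$ of $\min_{\bm{x}\in X}\{f_i(\bm{x})+g_i(\mathcal{X}^t,\bm{x})\}$; set $\mathit{lb}_t := \max\{\mathit{lb}_{t-1},\ \sum_{i=1}^N (f_i(\bm{x}^i_t)+g_i(\mathcal{X}^t,\bm{x}^i_t))\}$ with $\mathit{lb}_{-1}:=-\infty$; set $\mathcal{X}^{t+1}:=\mathcal{X}^t\cup\{\bm{x}^i_t: i\in[N]\}$ and form $g_i(\mathcal{X}^{t+1},\cdot)$. Complete Continuous Recourse: for each $i\in[N]$, $f_i$ is real-valued on $X$ and given by $$f_i(\bm{x})=\min_{\bm{y},\bm{z}}\{\ell(\bm{y},\bm{z}): L(\bm{x},\bm{y},\bm{z})\le\bm{0},\ \bm{y}\in Y\cap\mathbb{Z}^{p_2},\ \bm{z}\in Z\cap\mathbb{R}^{n_2-p_2}\}$$ (the data $\ell,L,Y,Z$ may depend on $i$), and either one of the following holds: 1. $\ell:\mathbb{R}^{n_2}\to\mathbb{R}$ and $L:\mathbb{R}^{n_1+n_2}\to\mathbb{R}^{m_2}$ are affine, $Y$ and $Z$ are polyhedral, and for all $\bm{x}\in X$ and $\bm{y}\in Y\cap\mathbb{Z}^{p_2}$ there exists $\bm{z}\in Z\cap\mathbb{R}^{n_2-p_2}$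 with $L(\bm{x},\bm{y},\bm{z})\le\bm{0}$; 2. $\ell$ and $L$ are Lipschitz continuous, $L$ is (componentwise) convex in $\bm{z}$ (not necessarily in $\bm{x}$ or $\bm{y}$), $Y$ is compact, $Z$ is compact and convex, and there exists $\delta>0$ such that for all $\bm{x}\in X$ and $\bm{y}\in Y\cap\mathbb{Z}^{p_2}$ there exists $\bm{z}\in Z\cap\mathbb{R}^{n_2-p_2}$ with every component of $L(\bm{x},\bm{y},\bm{z})$ less than $-\delta$. *)

theory Defs
  imports "HOL-Analysis.Analysis"
begin

section \<open>Mixed-integer coordinates\<close>

text \<open>
  A coordinate set \<open>J\<close> of \<open>real ^ 'd\<close> plays the role of the integer coordinates. It may be empty
  or everything, so that neither the integer nor the continuous block has to be non-trivial.
\<close>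

definition integral_on :: "'d::finite set \<Rightarrow> (real ^ 'd) set" where
  "integral_on J = {v. \<forall>j\<in>J. v $ j \<in> \<int>}"

text \<open>
  The block \<open>\<real>\<^sup>J\<close>, realised as a subspace of the whole space. With \<open>y\<close> in \<open>coord_space J\<close> and \<open>z\<close>
  in \<open>coord_space (- J)\<close>, the vector \<open>(y, z)\<close> is \<open>y + z\<close>. A subset of the subspace is polyhedral,
  compact or convex in the ambient space iff it is so in the subspace.
\<close>

definition coord_space :: "'d::finite set \<Rightarrow> (real ^ 'd) set" where
  "coord_space J = {v. \<forall>j. j \<notin> J \<longrightarrow> v $ j = 0}"

definition affine_map :: "('a::real_vector \<Rightarrow> 'b::real_vector) \<Rightarrow> bool" where
  "affine_map h \<longleftrightarrow> (\<exists>A b. linear A \<and> h = (\<lambda>v. A v + b))"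


section \<open>Complete continuous recourse\<close>

definition recourse_values ::
  "'m::finite set \<Rightarrow> (real ^ 'm \<Rightarrow> real) \<Rightarrow> ((real ^ 'n::finite) \<times> (real ^ 'm) \<Rightarrow> real ^ 'k::finite) \<Rightarrow>
   (real ^ 'm) set \<Rightarrow> (real ^ 'm) set \<Rightarrow> real ^ 'n \<Rightarrow> real set"
  where
  "recourse_values J l L Y Z x =
     {l (y + z) | y z. L (x, y + z) \<le> 0 \<and> y \<in> Y \<inter> integral_on J \<and> z \<in> Z}"

definition affine_recourse ::
  "'m::finite set \<Rightarrow> (real ^ 'n::finite) set \<Rightarrow> (real ^ 'm \<Rightarrow> real) \<Rightarrow>
   ((real ^ 'n) \<times> (real ^ 'm) \<Rightarrow> real ^ 'k::finite) \<Rightarrow> (real ^ 'm) set \<Rightarrow> (real ^ 'm) set \<Rightarrow> bool"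
  where
  "affine_recourse J X l L Y Z \<longleftrightarrow>
     affine_map l \<and> affine_map L \<and> polyhedron Y \<and> polyhedron Z \<and>
     (\<forall>x\<in>X. \<forall>y\<in>Y \<inter> integral_on J. \<exists>z\<in>Z. L (x, y + z) \<le> 0)"

definition convex_recourse ::
  "'m::finite set \<Rightarrow> (real ^ 'n::finite) set \<Rightarrow> (real ^ 'm \<Rightarrow> real) \<Rightarrow>
   ((real ^ 'n) \<times> (real ^ 'm) \<Rightarrow> real ^ 'k::finite) \<Rightarrow> (real ^ 'm) set \<Rightarrow> (real ^ 'm) set \<Rightarrow> bool"
  where
  "convex_recourse J X l L Y Z \<longleftrightarrow>
     (\<exists>C. C-lipschitz_on UNIV l) \<and> (\<exists>C. C-lipschitz_on UNIV L) \<and>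
     (\<forall>x. \<forall>y\<in>coord_space J. \<forall>k. convex_on (coord_space (- J)) (\<lambda>z. L (x, y + z) $ k)) \<and>
     compact Y \<and> compact Z \<and> convex Z \<and>
     (\<exists>\<delta>>0. \<forall>x\<in>X. \<forall>y\<in>Y \<inter> integral_on J. \<exists>z\<in>Z. \<forall>k. L (x, y + z) $ k < - \<delta>)"

definition complete_continuous_recourse ::
  "'m::finite set \<Rightarrow> (real ^ 'n::finite) set \<Rightarrow> (real ^ 'n \<Rightarrow> real) \<Rightarrow> (real ^ 'm \<Rightarrow> real) \<Rightarrow>
   ((real ^ 'n) \<times> (real ^ 'm) \<Rightarrow> real ^ 'k::finite) \<Rightarrow> (real ^ 'm) set \<Rightarrow> (real ^ 'm) set \<Rightarrow> bool"
  where
  "complete_continuous_recourse J X f l L Y Z \<longleftrightarrow>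
     Y \<subseteq> coord_space J \<and> Z \<subseteq> coord_space (- J) \<and>
     (\<forall>x\<in>X. f x \<in> recourse_values J l L Y Z x \<and> (\<forall>v\<in>recourse_values J l L Y Z x. f x \<le> v)) \<and>
     (affine_recourse J X l L Y Z \<or> convex_recourse J X l L Y Z)"


section \<open>Cuts\<close>

definition g_star :: "nat \<Rightarrow> (nat \<Rightarrow> 'a \<Rightarrow> real) \<Rightarrow> nat \<Rightarrow> 'a \<Rightarrow> real" where
  "g_star N f i x = (\<Sum>j = 1..N. f j x) / real N - f i x"

text \<open>\<open>cutf c x\<close> is the value at \<open>x\<close> of the cut generated at the point \<open>c\<close>.\<close>

definition valid_cuts :: "'a set \<Rightarrow> ('a \<Rightarrow> real) \<Rightarrow> ('a \<Rightarrow> 'a \<Rightarrow> real) \<Rightarrow> bool" where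
  "valid_cuts X g cutf \<longleftrightarrow> (\<forall>c\<in>X. \<forall>x\<in>X. g x \<ge> cutf c x)"

definition tight_cuts :: "'a set \<Rightarrow> ('a \<Rightarrow> real) \<Rightarrow> ('a \<Rightarrow> 'a \<Rightarrow> real) \<Rightarrow> bool" where
  "tight_cuts X g cutf \<longleftrightarrow> (\<forall>c\<in>X. g c = cutf c c)"

definition uniformly_lipschitz_cuts :: "'a::metric_space set \<Rightarrow> ('a \<Rightarrow> 'a \<Rightarrow> real) \<Rightarrow> bool" where
  "uniformly_lipschitz_cuts X cutf \<longleftrightarrow> (\<exists>C. \<forall>c\<in>X. C-lipschitz_on X (cutf c))"


section \<open>The iterative algorithm\<close>

text \<open>
  \<open>xs t i\<close> is the point computed for index \<open>i\<close> in iteration \<open>t\<close>. The cuts enter only through the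
  regularizers, which vanish for the empty (initial) set of points.
\<close>

definition regularizer :: "('a \<Rightarrow> 'a \<Rightarrow> real) \<Rightarrow> 'a set \<Rightarrow> 'a \<Rightarrow> real" where
  "regularizer cutf P x = (if P = {} then 0 else Max ((\<lambda>c. cutf c x) ` P))"

primrec gdd_points :: "nat \<Rightarrow> (nat \<Rightarrow> nat \<Rightarrow> 'a) \<Rightarrow> nat \<Rightarrow> 'a set" where
  "gdd_points N xs 0 = {}"
| "gdd_points N xs (Suc t) = gdd_points N xs t \<union> {xs t i | i. i \<in> {1..N}}"

definition gdd_objective ::
  "nat \<Rightarrow> (nat \<Rightarrow> 'a \<Rightarrow> real) \<Rightarrow> (nat \<Rightarrow> 'a \<Rightarrow> 'a \<Rightarrow> real) \<Rightarrow> (nat \<Rightarrow> nat \<Rightarrow> 'a) \<Rightarrow> nat \<Rightarrow> nat \<Rightarrow> 'a \<Rightarrow> real"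
  where
  "gdd_objective N f cutf xs t i x = f i x + regularizer (cutf i) (gdd_points N xs t) x"

text \<open>Any choice of optimal solutions of the subproblems is a run.\<close>

definition gdd_run ::
  "nat \<Rightarrow> 'a set \<Rightarrow> (nat \<Rightarrow> 'a \<Rightarrow> real) \<Rightarrow> (nat \<Rightarrow> 'a \<Rightarrow> 'a \<Rightarrow> real) \<Rightarrow> (nat \<Rightarrow> nat \<Rightarrow> 'a) \<Rightarrow> bool"
  where
  "gdd_run N X f cutf xs \<longleftrightarrow>
     (\<forall>t. \<forall>i\<in>{1..N}. is_arg_min (gdd_objective N f cutf xs t i) (\<lambda>x. x \<in> X) (xs t i))"

text \<open>Starting from \<open>- \<infinity>\<close>, the first bound is just the first sum.\<close>

primrec gdd_lb ::
  "nat \<Rightarrow> (nat \<Rightarrow> 'a \<Rightarrow> real) \<Rightarrow> (nat \<Rightarrow> 'a \<Rightarrow> 'a \<Rightarrow> real) \<Rightarrow> (nat \<Rightarrow> nat \<Rightarrow> 'a) \<Rightarrow> nat \<Rightarrow> real"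
  where
  "gdd_lb N f cutf xs 0 = (\<Sum>i = 1..N. gdd_objective N f cutf xs 0 i (xs 0 i))"
| "gdd_lb N f cutf xs (Suc t) =
     max (gdd_lb N f cutf xs t) (\<Sum>i = 1..N. gdd_objective N f cutf xs (Suc t) i (xs (Suc t) i))"

end

theory Submission
  imports Defs
begin

text \<open>
  Lower semicontinuity of the \<open>f i\<close> is all that is used of complete continuous recourse. With compact
  \<open>Y\<close> and \<open>Z\<close>, sublevel sets are projections of compact sets. In the affine case \<open>f i\<close> is even Lipschitz:
  Fourier-Motzkin elimination of the continuous recourse variables leaves finitely many inequalities
  \<open>0 \<le> s * t + h x y\<close> with \<open>s \<ge> 0\<close> and \<open>h\<close> Lipschitz in \<open>x\<close> uniformly in \<open>y\<close>, which describe the costs \<open>t\<close>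
  attainable from \<open>x\<close> and \<open>y\<close>; those with \<open>s = 0\<close> hold by recourse, so moving \<open>x\<close> changes the least
  \<open>t\<close> in a Lipschitz way.

  Write \<open>v\<close> for the minimum of \<open>\<Sum>i. f i\<close>. By validity, the optimal value of each subproblem is at most
  \<open>v / N\<close>, and from the second iteration on it increases. By compactness the points computed for \<open>i\<close>
  come back arbitrarily close to earlier ones \<open>c\<close>, without \<open>f i\<close> dropping noticeably. There the cut
  generated at \<open>c\<close>, being tight and Lipschitz, makes the optimal value at least
  \<open>(\<Sum>j. f j c) / N \<ge> v / N\<close> up to an arbitrarily small error. Hence every subproblem value tends
  to \<open>v / N\<close>, and their sum, which is squeezed below the lower bounds, tends to \<open>v\<close>.
\<close>

section \<open>Fourier-Motzkin elimination\<close>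

lemma ex_between_finite:
  fixes A B :: "'a::{linorder,zero} set"
  assumes "finite A" "finite B" "\<And>a b. a \<in> A \<Longrightarrow> b \<in> B \<Longrightarrow> a \<le> b"
  shows "\<exists>t. (\<forall>a\<in>A. a \<le> t) \<and> (\<forall>b\<in>B. t \<le> b)"
proof (cases "A = {}")
  case True
  show ?thesis
  proof (cases "B = {}")
    case False
    then show ?thesis using True assms(2) by (intro exI[of _ "Min B"]) auto
  qed (use True in auto)
next
  case False
  then show ?thesis using assms by (intro exI[of _ "Max A"]) auto
qed

text \<open>A negative coefficient gives the lower bound \<open>d j / c j\<close> on
  \<open>t\<close>, a positive one an upper bound; a solution exists iff no lower bound exceeds an
  upper one. Multiplied out, the pairwise conditions are nonnegative combinations of the given
  inequalities.\<close>

lemma ex_scalar_linear_inequalities_iff: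
  fixes c d :: "'i \<Rightarrow> real"
  assumes "finite S"
  shows "(\<exists>t. \<forall>i\<in>S. c i * t \<le> d i) \<longleftrightarrow>
    (\<forall>i\<in>S. c i = 0 \<longrightarrow> 0 \<le> d i) \<and>
    (\<forall>i\<in>S. \<forall>j\<in>S. 0 < c i \<longrightarrow> c j < 0 \<longrightarrow> 0 \<le> - c j * d i + c i * d j)" (is "?L \<longleftrightarrow> ?R")
proof
  assume ?L
  then obtain t where t: "\<And>i. i \<in> S \<Longrightarrow> c i * t \<le> d i" by blast
  have "0 \<le> d i" if "i \<in> S" "c i = 0" for i
    using t[OF that(1)] that(2) by simp
  moreover have "0 \<le> - c j * d i + c i * d j" if "i \<in> S" "j \<in> S" "0 < c i" "c j < 0" for i j
  proof -
    have "- c j * (c i * t) \<le> - c j * d i" "c i * (c j * t) \<le> c i * d j"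
      using t that by (auto intro!: mult_left_mono simp del: mult_minus_left)
    then show ?thesis by (simp add: algebra_simps)
  qed
  ultimately show ?R by blast
next
  assume R: ?R
  let ?A = "(\<lambda>j. d j / c j) ` {j\<in>S. c j < 0}" and ?B = "(\<lambda>i. d i / c i) ` {i\<in>S. 0 < c i}"
  have "\<exists>t. (\<forall>a\<in>?A. a \<le> t) \<and> (\<forall>b\<in>?B. t \<le> b)"
  proof (rule ex_between_finite)
    fix a b assume "a \<in> ?A" "b \<in> ?B"
    then obtain i j where ij: "i \<in> S" "j \<in> S" "0 < c i" "c j < 0" "a = d j / c j" "b = d i / c i"
      by auto
    have "0 \<le> - c j * d i + c i * d j" using R ij by blast
    then have "d i * c j / c i \<le> d j" using ij(3) by (simp add: pos_divide_le_eq algebra_simps)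
    then show "a \<le> b" using ij(4-) by (simp add: neg_divide_le_eq)
  qed (use assms in auto)
  then obtain t where t: "\<And>j. j \<in> S \<Longrightarrow> c j < 0 \<Longrightarrow> d j / c j \<le> t"
    "\<And>i. i \<in> S \<Longrightarrow> 0 < c i \<Longrightarrow> t \<le> d i / c i" by auto
  have "c i * t \<le> d i" if "i \<in> S" for i
  proof (cases "c i" "0::real" rule: linorder_cases)
    case less
    then show ?thesis using t(1)[OF that] by (simp add: field_simps)
  next
    case equal
    then show ?thesis using R that by auto
  next
    case greater
    then show ?thesis using t(2)[OF that] by (simp add: field_simps)
  qed
  then show ?L by blast
qed

text \<open>
  Right-hand sides depend on a parameter \<open>p\<close>; \<open>Q\<close> records any property of this dependence that
  survives the nonnegative combinations formed by the elimination.
\<close>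

lemma fourier_motzkin_coordinates:
  fixes S :: "(('p \<Rightarrow> real) \<times> 'a::euclidean_space) set"
  assumes "finite B" "B \<subseteq> Basis" "finite S" "\<And>\<beta> a. (\<beta>, a) \<in> S \<Longrightarrow> Q \<beta>"
    and comb: "\<And>\<beta> \<gamma> s t. Q \<beta> \<Longrightarrow> Q \<gamma> \<Longrightarrow> 0 \<le> s \<Longrightarrow> 0 \<le> t \<Longrightarrow> Q (\<lambda>p. s * \<beta> p + t * \<gamma> p)"
  shows "\<exists>G. finite G \<and> (\<forall>\<gamma>\<in>G. Q \<gamma>) \<and>
    (\<forall>p. (\<exists>u. \<forall>(\<beta>, a)\<in>S. (\<Sum>b\<in>B. (a \<bullet> b) * u b) \<le> \<beta> p) \<longleftrightarrow> (\<forall>\<gamma>\<in>G. 0 \<le> \<gamma> p))"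
  using assms(1-4)
proof (induction B arbitrary: S rule: finite_induct)
  case empty
  then show ?case by (intro exI[of _ "fst ` S"]) force
next
  case (insert b B)
  let ?S0 = "{(\<beta>, a). (\<beta>, a) \<in> S \<and> a \<bullet> b = 0}"
  let ?Spm = "{((\<beta>, a), (\<gamma>, c)). (\<beta>, a) \<in> S \<and> (\<gamma>, c) \<in> S \<and> 0 < a \<bullet> b \<and> c \<bullet> b < 0}"
  \<comment> \<open>The weights \<open>- (c \<bullet> b)\<close> and \<open>a \<bullet> b\<close>
    cancel the coefficient of \<open>b\<close>; on \<open>?Spm\<close> both are positive, so
    \<open>Q\<close> survives.\<close>
  let ?comb = "\<lambda>((\<beta>, a), (\<gamma>, c)).
    ((\<lambda>p. - (c \<bullet> b) * \<beta> p + (a \<bullet> b) * \<gamma> p), - (c \<bullet> b) *\<^sub>R a + (a \<bullet> b) *\<^sub>R c)"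
  let ?S' = "?S0 \<union> ?comb ` ?Spm"
  have "?S0 \<subseteq> S" "?Spm \<subseteq> S \<times> S" by auto
  then have fin: "finite ?S'"
    using insert.prems(2) by (meson finite_SigmaI finite_UnI finite_imageI finite_subset)
  have Q: "Q \<beta>" if mem: "(\<beta>, a) \<in> ?S'" for \<beta> a
  proof (cases "(\<beta>, a) \<in> ?S0")
    case True
    then show ?thesis using insert.prems(3) by auto
  next
    case False
    then have "(\<beta>, a) \<in> ?comb ` ?Spm" using mem by blast
    then obtain \<beta>1 a1 \<gamma> c where "(\<beta>1, a1) \<in> S" "(\<gamma>, c) \<in> S" "0 < a1 \<bullet> b" "c \<bullet> b < 0"
      "\<beta> = (\<lambda>p. - (c \<bullet> b) * \<beta>1 p + (a1 \<bullet> b) * \<gamma> p)" by auto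
    then show ?thesis
      using comb[OF insert.prems(3) insert.prems(3), of \<beta>1 a1 \<gamma> c "- (c \<bullet> b)" "a1 \<bullet> b"] by simp
  qed
  have "B \<subseteq> Basis" using insert.prems(1) by simp
  then have "\<exists>G. finite G \<and> (\<forall>\<gamma>\<in>G. Q \<gamma>) \<and>
    (\<forall>p. (\<exists>u. \<forall>(\<beta>, a)\<in>?S'. (\<Sum>b\<in>B. (a \<bullet> b) * u b) \<le> \<beta> p) \<longleftrightarrow> (\<forall>\<gamma>\<in>G. 0 \<le> \<gamma> p))"
    by (rule insert.IH) (fact fin Q)+
  then obtain G where G: "finite G" "\<forall>\<gamma>\<in>G. Q \<gamma>"
    "\<forall>p. (\<exists>u. \<forall>(\<beta>, a)\<in>?S'. (\<Sum>b\<in>B. (a \<bullet> b) * u b) \<le> \<beta> p) \<longleftrightarrow> (\<forall>\<gamma>\<in>G. 0 \<le> \<gamma> p)"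
    by (elim exE conjE)
  \<comment> \<open>For fixed values \<open>u\<close> of the other coordinates this is the
    one-variable criterion, with those coordinates moved to the right-hand side.\<close>
  have elim: "(\<exists>t. \<forall>(\<beta>, a)\<in>S. (a \<bullet> b) * t \<le> \<beta> p - (\<Sum>b\<in>B. (a \<bullet> b) * u b)) \<longleftrightarrow>
      (\<forall>(\<beta>, a)\<in>?S'. (\<Sum>b\<in>B. (a \<bullet> b) * u b) \<le> \<beta> p)" for u p
  proof -
    have *: "(\<Sum>b'\<in>B. ((- (c \<bullet> b) *\<^sub>R a + (a \<bullet> b) *\<^sub>R c) \<bullet> b') * u b') =
       - (c \<bullet> b) * (\<Sum>b'\<in>B. (a \<bullet> b') * u b') + (a \<bullet> b) * (\<Sum>b'\<in>B. (c \<bullet> b') * u b')" for a c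
      unfolding sum_distrib_left sum.distrib[symmetric]
      by (intro sum.cong) (simp_all add: inner_add_left algebra_simps)
    let ?r = "\<lambda>\<beta> a. \<beta> p - (\<Sum>b\<in>B. (a \<bullet> b) * u b)"
    have "(\<exists>t. \<forall>(\<beta>, a)\<in>S. (a \<bullet> b) * t \<le> ?r \<beta> a) \<longleftrightarrow>
      (\<forall>(\<beta>, a)\<in>S. a \<bullet> b = 0 \<longrightarrow> 0 \<le> ?r \<beta> a) \<and>
      (\<forall>(\<beta>, a)\<in>S. \<forall>(\<gamma>, c)\<in>S. 0 < a \<bullet> b \<longrightarrow> c \<bullet> b < 0 \<longrightarrow>
        0 \<le> - (c \<bullet> b) * ?r \<beta> a + (a \<bullet> b) * ?r \<gamma> c)"
      using ex_scalar_linear_inequalities_iff[OF insert.prems(2),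
        of "\<lambda>i. snd i \<bullet> b" "\<lambda>i. ?r (fst i) (snd i)"]
      unfolding case_prod_unfold .
    also have "(\<forall>(\<beta>, a)\<in>S. a \<bullet> b = 0 \<longrightarrow> 0 \<le> ?r \<beta> a) \<longleftrightarrow>
      (\<forall>(\<beta>, a)\<in>?S0. (\<Sum>b\<in>B. (a \<bullet> b) * u b) \<le> \<beta> p)"
      by auto
    also have "(\<forall>(\<beta>, a)\<in>S. \<forall>(\<gamma>, c)\<in>S. 0 < a \<bullet> b \<longrightarrow> c \<bullet> b < 0 \<longrightarrow>
        0 \<le> - (c \<bullet> b) * ?r \<beta> a + (a \<bullet> b) * ?r \<gamma> c) \<longleftrightarrow>
      (\<forall>(\<beta>, a)\<in>S. \<forall>(\<gamma>, c)\<in>S. 0 < a \<bullet> b \<longrightarrow> c \<bullet> b < 0 \<longrightarrow>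
        (\<Sum>b'\<in>B. ((- (c \<bullet> b) *\<^sub>R a + (a \<bullet> b) *\<^sub>R c) \<bullet> b') * u b') \<le>
        - (c \<bullet> b) * \<beta> p + (a \<bullet> b) * \<gamma> p)"
      unfolding * by (simp add: algebra_simps)
    also have "\<dots> \<longleftrightarrow> (\<forall>(\<beta>, a)\<in>?comb ` ?Spm. (\<Sum>b\<in>B. (a \<bullet> b) * u b) \<le> \<beta> p)"
      unfolding ball_simps
      by (simp only: Ball_def split_paired_All mem_Collect_eq prod.case) blast
    finally show ?thesis unfolding ball_Un .
  qed
  have "(\<exists>u. \<forall>(\<beta>, a)\<in>S. (\<Sum>b\<in>insert b B. (a \<bullet> b) * u b) \<le> \<beta> p) \<longleftrightarrow>
      (\<exists>u. \<exists>t. \<forall>(\<beta>, a)\<in>S. (a \<bullet> b) * t \<le> \<beta> p - (\<Sum>b\<in>B. (a \<bullet> b) * u b))" (is "?L \<longleftrightarrow> ?R") for p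
  proof
    assume ?L
    then obtain u where "\<forall>(\<beta>, a)\<in>S. (\<Sum>b\<in>insert b B. (a \<bullet> b) * u b) \<le> \<beta> p" by blast
    then show ?R using insert.hyps by (intro exI[of _ u] exI[of _ "u b"]) (auto simp: algebra_simps)
  next
    assume ?R
    then obtain u t where ut: "\<forall>(\<beta>, a)\<in>S. (a \<bullet> b) * t \<le> \<beta> p - (\<Sum>b\<in>B. (a \<bullet> b) * u b)" by blast
    have "(\<Sum>b'\<in>B. (a \<bullet> b') * (u(b := t)) b') = (\<Sum>b'\<in>B. (a \<bullet> b') * u b')" for a
      using insert.hyps by (intro sum.cong) auto
    then show ?L using ut insert.hyps
      by (intro exI[of _ "u(b := t)"]) (auto simp: algebra_simps simp del: fun_upd_apply simp: fun_upd_same)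
  qed
  then show ?case unfolding elim using G by (intro exI[of _ G] conjI) simp_all
qed

text \<open>Coordinates over \<open>Basis\<close> are traded for vectors. One finite
  \<open>G\<close> serves all \<open>p\<close>, which makes bounds uniform in the parameter
  possible.\<close>

lemma fourier_motzkin:
  fixes S :: "(('p \<Rightarrow> real) \<times> 'a::euclidean_space) set"
  assumes "finite S" "\<And>\<beta> a. (\<beta>, a) \<in> S \<Longrightarrow> Q \<beta>"
    and "\<And>\<beta> \<gamma> s t. Q \<beta> \<Longrightarrow> Q \<gamma> \<Longrightarrow> 0 \<le> s \<Longrightarrow> 0 \<le> t \<Longrightarrow> Q (\<lambda>p. s * \<beta> p + t * \<gamma> p)"
  shows "\<exists>G. finite G \<and> (\<forall>\<gamma>\<in>G. Q \<gamma>) \<and>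
    (\<forall>p. (\<exists>z. \<forall>(\<beta>, a)\<in>S. a \<bullet> z \<le> \<beta> p) \<longleftrightarrow> (\<forall>\<gamma>\<in>G. 0 \<le> \<gamma> p))"
proof -
  have "\<exists>G. finite G \<and> (\<forall>\<gamma>\<in>G. Q \<gamma>) \<and>
    (\<forall>p. (\<exists>u. \<forall>(\<beta>, a)\<in>S. (\<Sum>b\<in>Basis. (a \<bullet> b) * u b) \<le> \<beta> p) \<longleftrightarrow> (\<forall>\<gamma>\<in>G. 0 \<le> \<gamma> p))"
    by (rule fourier_motzkin_coordinates) (fact finite_Basis subset_refl assms)+
  then obtain G where G: "finite G" "\<forall>\<gamma>\<in>G. Q \<gamma>"
    "\<forall>p. (\<exists>u. \<forall>(\<beta>, a)\<in>S. (\<Sum>b\<in>Basis. (a \<bullet> b) * u b) \<le> \<beta> p) \<longleftrightarrow> (\<forall>\<gamma>\<in>G. 0 \<le> \<gamma> p)"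
    by (elim exE conjE)
  have "(\<exists>z. \<forall>(\<beta>, a)\<in>S. a \<bullet> z \<le> \<beta> p) \<longleftrightarrow>
      (\<exists>u. \<forall>(\<beta>, a)\<in>S. (\<Sum>b\<in>Basis. (a \<bullet> b) * u b) \<le> \<beta> p)" (is "?L \<longleftrightarrow> ?R") for p
  proof
    assume ?L
    then obtain z where "\<forall>(\<beta>, a)\<in>S. a \<bullet> z \<le> \<beta> p" by blast
    then show ?R by (intro exI[of _ "\<lambda>b. z \<bullet> b"]) (simp add: euclidean_inner[symmetric])
  next
    assume ?R
    then obtain u where "\<forall>(\<beta>, a)\<in>S. (\<Sum>b\<in>Basis. (a \<bullet> b) * u b) \<le> \<beta> p" by blast
    then show ?L by (intro exI[of _ "\<Sum>b\<in>Basis. u b *\<^sub>R b"]) (simp add: inner_sum_right mult.commute)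
  qed
  then show ?thesis using G by (intro exI[of _ G]) simp
qed

section \<open>Lipschitz dependence of affine recourse on the first stage\<close>

text \<open>
  The parameter is a triple of a first-stage point \<open>x\<close>, an integer part \<open>y\<close> and an upper bound \<open>t\<close>
  on the cost. A nonnegative slope in \<open>t\<close> means that an error caused by moving \<open>x\<close> can be compensated
  by raising \<open>t\<close>; the Lipschitz constant does not depend on \<open>y\<close>, which may range over an infinite set.
\<close>

definition affine_lipschitz_rhs :: "('x::metric_space \<times> 'y \<times> real \<Rightarrow> real) \<Rightarrow> bool" where
  "affine_lipschitz_rhs \<gamma> \<longleftrightarrow> (\<exists>s\<ge>0. \<exists>h C. 0 \<le> C \<and> (\<forall>x y t. \<gamma> (x, y, t) = s * t + h x y) \<and>
     (\<forall>x x' y. h x y \<le> h x' y + C * dist x x'))"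

lemma affine_lipschitz_rhsI:
  assumes "0 \<le> s" "0 \<le> C" "\<And>x y t. \<gamma> (x, y, t) = s * t + h x y"
    "\<And>x x' y. h x y \<le> h x' y + C * dist x x'"
  shows "affine_lipschitz_rhs \<gamma>"
  unfolding affine_lipschitz_rhs_def using assms by blast

lemma affine_lipschitz_rhs_combination:
  assumes "affine_lipschitz_rhs \<beta>" "affine_lipschitz_rhs \<gamma>" "0 \<le> a" "0 \<le> b"
  shows "affine_lipschitz_rhs (\<lambda>p. a * \<beta> p + b * \<gamma> p)"
proof -
  from assms(1) obtain s h C where 1: "0 \<le> s" "0 \<le> C" "\<And>x y t. \<beta> (x, y, t) = s * t + h x y"
    "\<And>x x' y. h x y \<le> h x' y + C * dist x x'" unfolding affine_lipschitz_rhs_def by blast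
  from assms(2) obtain s' h' C' where 2: "0 \<le> s'" "0 \<le> C'" "\<And>x y t. \<gamma> (x, y, t) = s' * t + h' x y"
    "\<And>x x' y. h' x y \<le> h' x' y + C' * dist x x'" unfolding affine_lipschitz_rhs_def by blast
  show ?thesis
  proof (rule affine_lipschitz_rhsI[where s = "a * s + b * s'" and C = "a * C + b * C'"
        and h = "\<lambda>x y. a * h x y + b * h' x y"])
    fix x x' y
    have "a * h x y \<le> a * (h x' y + C * dist x x')" "b * h' x y \<le> b * (h' x' y + C' * dist x x')"
      using 1 2 assms by (auto intro: mult_left_mono)
    then show "a * h x y + b * h' x y \<le> a * h x' y + b * h' x' y + (a * C + b * C') * dist x x'"
      by (simp add: algebra_simps)
  qed (use 1 2 assms in \<open>auto simp: algebra_simps\<close>)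
qed

text \<open>Elimination leaves finitely many conditions \<open>0 \<le> s * t + h x y\<close>. For
  \<open>s > 0\<close>, raising \<open>t\<close> by \<open>C / s * dist x x'\<close> offsets the
  change of \<open>h\<close>.\<close>

lemma parametric_feasibility_lipschitz:
  fixes S :: "(('x::metric_space \<times> 'y \<times> real \<Rightarrow> real) \<times> 'a::euclidean_space) set"
  assumes "finite S" "\<And>\<beta> a. (\<beta>, a) \<in> S \<Longrightarrow> affine_lipschitz_rhs \<beta>"
  obtains M where "0 \<le> M"
    "\<And>x x' y t t'. \<exists>z. \<forall>(\<beta>, a)\<in>S. a \<bullet> z \<le> \<beta> (x, y, t) \<Longrightarrow>
       \<exists>z. \<forall>(\<beta>, a)\<in>S. a \<bullet> z \<le> \<beta> (x', y, t') \<Longrightarrow>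
       \<exists>z. \<forall>(\<beta>, a)\<in>S. a \<bullet> z \<le> \<beta> (x', y, t + M * dist x x')"
proof -
  have "\<exists>G. finite G \<and> (\<forall>\<gamma>\<in>G. affine_lipschitz_rhs \<gamma>) \<and>
    (\<forall>p. (\<exists>z. \<forall>(\<beta>, a)\<in>S. a \<bullet> z \<le> \<beta> p) \<longleftrightarrow> (\<forall>\<gamma>\<in>G. 0 \<le> \<gamma> p))"
    by (rule fourier_motzkin) (fact assms affine_lipschitz_rhs_combination)+
  then obtain G where G: "finite G" "\<forall>\<gamma>\<in>G. affine_lipschitz_rhs \<gamma>"
    "\<forall>p. (\<exists>z. \<forall>(\<beta>, a)\<in>S. a \<bullet> z \<le> \<beta> p) \<longleftrightarrow> (\<forall>\<gamma>\<in>G. 0 \<le> \<gamma> p)"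
    by (elim exE conjE)
  have "\<forall>\<gamma>\<in>G. \<exists>K\<ge>0. \<forall>x x' y t t' M. 0 \<le> \<gamma> (x, y, t) \<longrightarrow> 0 \<le> \<gamma> (x', y, t') \<longrightarrow> K \<le> M \<longrightarrow>
      0 \<le> \<gamma> (x', y, t + M * dist x x')"
  proof
    fix \<gamma> assume "\<gamma> \<in> G"
    then obtain s h C where *: "0 \<le> s" "0 \<le> C" "\<And>x y t. \<gamma> (x, y, t) = s * t + h x y"
      "\<And>x x' y. h x y \<le> h x' y + C * dist x x'" using G(2) unfolding affine_lipschitz_rhs_def by blast
    show "\<exists>K\<ge>0. \<forall>x x' y t t' M. 0 \<le> \<gamma> (x, y, t) \<longrightarrow> 0 \<le> \<gamma> (x', y, t') \<longrightarrow> K \<le> M \<longrightarrow>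
      0 \<le> \<gamma> (x', y, t + M * dist x x')"
    \<comment> \<open>For \<open>s = 0\<close> the quotient is \<open>0\<close> by convention; then
      \<gamma> does not depend on its last argument, and feasibility at \<open>t'\<close> carries
      over to every cost.\<close>
    proof (intro exI[of _ "C / s"] conjI allI impI)
      fix x x' y t t' M assume a: "0 \<le> \<gamma> (x, y, t)" "0 \<le> \<gamma> (x', y, t')" "C / s \<le> M"
      show "0 \<le> \<gamma> (x', y, t + M * dist x x')"
      proof (cases "s = 0")
        case False
        then have "C \<le> s * M" using *(1) a(3) by (simp add: field_simps)
        then have "C * dist x x' \<le> s * M * dist x x'" by (intro mult_right_mono) auto
        then show ?thesis using a(1) *(4)[of x y x'] by (simp add: *(3) algebra_simps)
      qed (use a(2) in \<open>simp add: *(3)\<close>)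
    qed (use * in auto)
  qed
  then obtain K where K: "\<And>\<gamma>. \<gamma> \<in> G \<Longrightarrow> 0 \<le> K \<gamma>"
    "\<And>\<gamma> x x' y t t' M. \<gamma> \<in> G \<Longrightarrow> 0 \<le> \<gamma> (x, y, t) \<Longrightarrow> 0 \<le> \<gamma> (x', y, t') \<Longrightarrow> K \<gamma> \<le> M \<Longrightarrow>
      0 \<le> \<gamma> (x', y, t + M * dist x x')" by metis
  \<comment> \<open>A sum instead of a maximum also covers an empty \<open>G\<close>.\<close>
  have le: "K \<gamma> \<le> sum K G" if "\<gamma> \<in> G" for \<gamma>
    using K(1) that G(1) by (intro member_le_sum) auto
  show thesis
  proof (rule that[of "sum K G"])
    show "0 \<le> sum K G" using K(1) by (rule sum_nonneg)
  next
    fix x x' :: 'x and y :: 'y and t t' :: real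
    show "\<exists>z. \<forall>(\<beta>, a)\<in>S. a \<bullet> z \<le> \<beta> (x, y, t) \<Longrightarrow> \<exists>z. \<forall>(\<beta>, a)\<in>S. a \<bullet> z \<le> \<beta> (x', y, t') \<Longrightarrow>
       \<exists>z. \<forall>(\<beta>, a)\<in>S. a \<bullet> z \<le> \<beta> (x', y, t + sum K G * dist x x')"
      unfolding G(3)[rule_format] using K(2) le by blast
  qed
qed

lemma linear_functional_inner:
  fixes g :: "'a::euclidean_space \<Rightarrow> real"
  assumes "linear g"
  shows "\<exists>a. \<forall>z. g z = a \<bullet> z"
  using adjoint_works[OF assms, of _ 1] by (intro exI[of _ "adjoint g 1"]) (simp add: inner_commute)

text \<open>The integer part \<open>y\<close> that is optimal at \<open>x\<close> is kept at
  \<open>x'\<close>, and only \<open>z\<close> is readjusted. The constant is uniform in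
  \<open>y\<close>, so infinitely many integer parts do no harm; exchanging \<open>x\<close> and
  \<open>x'\<close> gives the other inequality.\<close>

lemma affine_recourse_lipschitz:
  fixes f :: "real ^ 'n::finite \<Rightarrow> real"
    and L :: "(real ^ 'n) \<times> (real ^ 'm::finite) \<Rightarrow> real ^ 'k::finite"
  assumes "complete_continuous_recourse J X f l L Y Z" "affine_recourse J X l L Y Z"
  obtains M where "M-lipschitz_on X f"
proof -
  obtain A b where L: "linear A" "L = (\<lambda>v. A v + b)"
    using assms(2) unfolding affine_recourse_def affine_map_def by blast
  obtain A' b' where l: "linear A'" "l = (\<lambda>v. A' v + b')"
    using assms(2) unfolding affine_recourse_def affine_map_def by blast
  obtain F where F: "finite F" "Z = \<Inter>F" "\<forall>h\<in>F. \<exists>a b. a \<noteq> 0 \<and> h = {x. a \<bullet> x \<le> b}"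
    using assms(2) unfolding affine_recourse_def polyhedron_def by blast
  then obtain n e where ne: "\<And>h. h \<in> F \<Longrightarrow> h = {x. n h \<bullet> x \<le> e h}" by metis
  have "\<exists>a. \<forall>z. A (0, z) $ k = a \<bullet> z" for k
  proof -
    have "linear (\<lambda>z. A (0, z) $ k)"
      using bounded_linear.linear[OF bounded_linear_compose[OF bounded_linear_vec_nth
            bounded_linear_compose[OF linear_conv_bounded_linear[THEN iffD1, OF L(1)]
              bounded_linear_Pair[OF bounded_linear_zero bounded_linear_ident]]]] .
    then show ?thesis by (rule linear_functional_inner)
  qed
  then obtain r where r: "\<And>k z. A (0, z) $ k = r k \<bullet> z" by metis
  obtain c where c: "\<And>z. A' z = c \<bullet> z" using linear_functional_inner[OF l(1)] by blast
  define \<beta> :: "'k \<Rightarrow> (real ^ 'n) \<times> (real ^ 'm) \<times> real \<Rightarrow> real"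
    where "\<beta> k = (\<lambda>(x, y, t). - L (x, y) $ k)" for k
  define \<beta>l :: "(real ^ 'n) \<times> (real ^ 'm) \<times> real \<Rightarrow> real" where "\<beta>l = (\<lambda>(x, y, t). t - l y)"
  \<comment> \<open>The inequalities in \<open>z\<close>: the halfspaces of \<open>Z\<close>, the
    recourse constraints, and the cost bound \<open>l (y + z) \<le> t\<close>. Only the last
    involves \<open>t\<close>, with slope 1.\<close>
  define S where "S = (\<lambda>h. (\<lambda>_::(real ^ 'n) \<times> (real ^ 'm) \<times> real. e h, n h)) ` F \<union>
    range (\<lambda>k. (\<beta> k, r k)) \<union> {(\<beta>l, c)}"
  have Lz: "L (x, y + z) $ k = L (x, y) $ k + r k \<bullet> z" for x y z k
  proof -
    have "A (x, y + z) = A (x, y) + A (0, z)" using linear_add[OF L(1), of "(x, y)" "(0, z)"] by simp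
    then show ?thesis unfolding L(2) by (simp add: r)
  qed
  have lz: "l (y + z) = l y + c \<bullet> z" for y z
    using linear_add[OF l(1)] unfolding l(2) by (simp add: c)
  have S: "(\<exists>z. \<forall>(\<beta>, a)\<in>S. a \<bullet> z \<le> \<beta> (x, y, t)) \<longleftrightarrow>
      (\<exists>z\<in>Z. L (x, y + z) \<le> 0 \<and> l (y + z) \<le> t)" for x y t
  proof -
    have "(\<forall>(\<beta>, a)\<in>S. a \<bullet> z \<le> \<beta> (x, y, t)) \<longleftrightarrow> z \<in> Z \<and> L (x, y + z) \<le> 0 \<and> l (y + z) \<le> t" for z
    proof -
      have "z \<in> Z \<longleftrightarrow> (\<forall>h\<in>F. n h \<bullet> z \<le> e h)" using F(2) ne by auto
      moreover have "L (x, y + z) \<le> 0 \<longleftrightarrow> (\<forall>k. r k \<bullet> z \<le> - L (x, y) $ k)"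
        unfolding less_eq_vec_def Lz zero_index by (metis add.commute le_diff_eq diff_0)
      moreover have "l (y + z) \<le> t \<longleftrightarrow> c \<bullet> z \<le> t - l y" unfolding lz by linarith
      ultimately show ?thesis unfolding S_def \<beta>_def \<beta>l_def by (auto simp: ball_Un)
    qed
    then show ?thesis by blast
  qed
  have "finite S" unfolding S_def using F(1) by simp
  moreover have "affine_lipschitz_rhs \<gamma>" if "(\<gamma>, a) \<in> S" for \<gamma> a
  proof -
    have "affine_lipschitz_rhs (\<lambda>_::(real ^ 'n) \<times> (real ^ 'm) \<times> real. e h)" for h
      by (rule affine_lipschitz_rhsI[where s = 0 and C = 0 and h = "\<lambda>_ _. e h"]) auto
    moreover have "affine_lipschitz_rhs \<beta>l"
      by (rule affine_lipschitz_rhsI[where s = 1 and C = 0 and h = "\<lambda>_ y. - l y"]) (auto simp: \<beta>l_def)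
    moreover have "affine_lipschitz_rhs (\<beta> k)" for k
    proof -
      obtain C where C: "C > 0" "\<And>v. norm (A v) \<le> C * norm v"
        using linear_bounded_pos[OF L(1)] by blast
      show ?thesis
      proof (rule affine_lipschitz_rhsI[where s = 0 and C = C and h = "\<lambda>x y. - L (x, y) $ k"])
        fix x x' :: "real ^ 'n" and y :: "real ^ 'm"
        \<comment> \<open>The integer part cancels in the difference, hence a constant uniform in
          \<open>y\<close>.\<close>
        have "L (x', y) - L (x, y) = A (x' - x, 0)"
          unfolding L(2) using linear_diff[OF L(1), of "(x', y)" "(x, y)"] by simp
        then have "L (x', y) $ k - L (x, y) $ k = A (x' - x, 0) $ k"
          by (metis vector_minus_component)
        also have "\<dots> \<le> norm (A (x' - x, 0))" using component_le_norm_cart[of "A (x' - x, 0)" k] by simp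
        also have "\<dots> \<le> C * dist x x'" using C(2)[of "(x' - x, 0)"] by (simp add: norm_Pair dist_norm norm_minus_commute)
        finally show "- L (x, y) $ k \<le> - L (x', y) $ k + C * dist x x'" by simp
      qed (use C in \<open>auto simp: \<beta>_def\<close>)
    qed
    ultimately show ?thesis using that unfolding S_def by auto
  qed
  ultimately obtain M where M: "0 \<le> M"
    "\<And>x x' y t t'. \<exists>z. \<forall>(\<beta>, a)\<in>S. a \<bullet> z \<le> \<beta> (x, y, t) \<Longrightarrow>
       \<exists>z. \<forall>(\<beta>, a)\<in>S. a \<bullet> z \<le> \<beta> (x', y, t') \<Longrightarrow>
       \<exists>z. \<forall>(\<beta>, a)\<in>S. a \<bullet> z \<le> \<beta> (x', y, t + M * dist x x')"
    using parametric_feasibility_lipschitz[of S] by blast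
  have le: "f x' \<le> f x + M * dist x x'" if "x \<in> X" "x' \<in> X" for x x'
  proof -
    have "f x \<in> recourse_values J l L Y Z x"
      using assms(1) that unfolding complete_continuous_recourse_def by blast
    then obtain y z where yz: "f x = l (y + z)" "L (x, y + z) \<le> 0" "y \<in> Y \<inter> integral_on J" "z \<in> Z"
      unfolding recourse_values_def by blast
    have "\<forall>x\<in>X. \<forall>y\<in>Y \<inter> integral_on J. \<exists>z\<in>Z. L (x, y + z) \<le> 0"
      using assms(2) unfolding affine_recourse_def by simp
    \<comment> \<open>Recourse makes \<open>y\<close> feasible at \<open>x'\<close> with some cost,
      the \<open>t'\<close> of the parametric bound.\<close>
    then obtain z1 where z1: "z1 \<in> Z" "L (x', y + z1) \<le> 0" using \<open>x' \<in> X\<close> yz(3) by meson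
    have "\<exists>z\<in>Z. L (x', y + z) \<le> 0 \<and> l (y + z) \<le> f x + M * dist x x'"
      using M(2)[of x y "f x" x' "l (y + z1)"] yz z1 unfolding S by auto
    then obtain z' where z': "z' \<in> Z" "L (x', y + z') \<le> 0" "l (y + z') \<le> f x + M * dist x x'" by blast
    then have "l (y + z') \<in> recourse_values J l L Y Z x'"
      using yz(3) unfolding recourse_values_def by blast
    then have "f x' \<le> l (y + z')"
      using assms(1) that unfolding complete_continuous_recourse_def by blast
    then show ?thesis using z'(3) by linarith
  qed
  have "M-lipschitz_on X f"
  proof (rule lipschitz_onI)
    fix x x' assume "x \<in> X" "x' \<in> X"
    then show "dist (f x) (f x') \<le> M * dist x x'"
      using le[of x x'] le[of x' x] by (auto simp: dist_real_def dist_commute abs_le_iff)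
  qed (use M in simp)
  then show thesis by (rule that)
qed

section \<open>Lower semicontinuity\<close>

text \<open>Relative openness of superlevel sets fits functions given on \<open>X\<close> and feeds
  directly into compactness by open covers.\<close>

definition lsc_on :: "'a::topological_space set \<Rightarrow> ('a \<Rightarrow> real) \<Rightarrow> bool" where
  "lsc_on X f \<longleftrightarrow> (\<forall>a. openin (top_of_set X) {x\<in>X. a < f x})"

lemma lsc_on_continuous:
  assumes "continuous_on X f"
  shows "lsc_on X f"
  unfolding lsc_on_def
proof
  fix a
  have "{x\<in>X. a < f x} = X \<inter> f -` {a<..}" by auto
  then show "openin (top_of_set X) {x\<in>X. a < f x}"
    using assms by (simp add: continuous_openin_preimage_gen)
qed

lemma lsc_on_add:
  assumes "lsc_on X f" "lsc_on X g"
  shows "lsc_on X (\<lambda>x. f x + g x)"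
  unfolding lsc_on_def
proof
  fix a
  \<comment> \<open>The excess of \<open>f x + g x\<close> over \<open>a\<close> is split in half
    between the two summands.\<close>
  have "\<exists>q. q < f x \<and> a - q < g x" if "a < f x + g x" for x
    using that by (intro exI[of _ "f x - (f x + g x - a) / 2"]) (auto simp: field_simps)
  then have "{x\<in>X. a < f x + g x} = (\<Union>q. {x\<in>X. q < f x} \<inter> {x\<in>X. a - q < g x})"
    by fastforce
  then show "openin (top_of_set X) {x\<in>X. a < f x + g x}"
    using assms unfolding lsc_on_def by (auto intro!: openin_Union openin_Int)
qed

lemma lsc_on_sum:
  assumes "\<And>i. i \<in> I \<Longrightarrow> lsc_on X (f i)"
  shows "lsc_on X (\<lambda>x. \<Sum>i\<in>I. f i x)"
  using assms
proof (induction I rule: infinite_finite_induct)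
  case (insert i I)
  then show ?case by (simp add: lsc_on_add)
qed (simp_all add: lsc_on_continuous)

text \<open>Without a minimum, the sets where \<open>f\<close> exceeds some \<open>f y\<close> cover
  \<open>X\<close>. In a finite subcover, the \<open>y\<close> of least value lies in none of the
  sets.\<close>

lemma lsc_on_attains_inf:
  assumes "lsc_on X f" "compact X" "X \<noteq> {}"
  shows "\<exists>x\<in>X. \<forall>y\<in>X. f x \<le> f y"
proof (rule ccontr)
  assume "\<not> ?thesis"
  then have no: "\<exists>y\<in>X. f y < f x" if "x \<in> X" for x using that by force
  let ?U = "\<lambda>y. {x\<in>X. f y < f x}"
  have "X \<subseteq> \<Union> (?U ` X)" using no by auto
  moreover have "\<forall>c\<in>?U ` X. openin (top_of_set X) c" using assms(1) unfolding lsc_on_def by auto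
  ultimately have "\<exists>D\<subseteq>?U ` X. finite D \<and> X \<subseteq> \<Union>D"
    using assms(2)[unfolded compact_eq_openin_cover] by (elim allE[of _ "?U ` X"] impE) auto
  then obtain D where D: "D \<subseteq> ?U ` X" "finite D" "X \<subseteq> \<Union>D" by (elim exE conjE)
  obtain E where "E \<subseteq> X" "finite E" "D = ?U ` E"
    using finite_subset_image[OF D(2,1)] by (elim exE conjE)
  with D(3) have E: "E \<subseteq> X" "finite E" "X \<subseteq> \<Union> (?U ` E)" by simp_all
  then have "E \<noteq> {}" using assms(3) by auto
  then obtain y where y: "y \<in> E" "\<forall>z\<in>E. f y \<le> f z"
    using E(2) ex_is_arg_min_if_finite[of E f] by (auto simp: is_arg_min_linorder)
  then obtain z where "z \<in> E" "f z < f y" using E by auto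
  then show False using y by force
qed

section \<open>Lower semicontinuity of recourse functions\<close>

lemma closed_integral_on: "closed (integral_on J)"
proof -
  have "integral_on J = (\<Inter>j\<in>J. (\<lambda>v. v $ j) -` \<int>)" unfolding integral_on_def by auto
  moreover have "closed ((\<lambda>v::real ^ 'd::finite. v $ j) -` \<int>)" for j
    by (intro closed_vimage) (auto intro: continuous_intros)
  ultimately show ?thesis by auto
qed

lemma convex_recourse_lsc:
  assumes "complete_continuous_recourse J X f l L Y Z" "convex_recourse J X l L Y Z" "compact X"
  shows "lsc_on X f"
  unfolding lsc_on_def
proof
  fix a
  have contL: "continuous_on UNIV L" and contl: "continuous_on UNIV l"
    using assms(2) unfolding convex_recourse_def by (auto dest: lipschitz_on_continuous_on)
  define W where "W = X \<times> (Y \<inter> integral_on J) \<times> Z"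
  define W' where "W' = W \<inter> {(x, y, z). L (x, y + z) \<le> 0 \<and> l (y + z) \<le> a}"
  have "compact W" unfolding W_def using assms(2,3) unfolding convex_recourse_def
    by (intro compact_Times compact_Int_closed closed_integral_on) auto
  moreover have "closed {(x, y, z). L (x, y + z) \<le> 0 \<and> l (y + z) \<le> a}"
    unfolding case_prod_unfold less_eq_vec_def
    by (intro closed_Collect_conj closed_Collect_all closed_Collect_le continuous_intros
        continuous_on_compose2[OF contL] continuous_on_compose2[OF contl]) auto
  ultimately have "compact W'" unfolding W'_def by (rule compact_Int_closed)
  then have "closed (fst ` W')"
    by (intro compact_imp_closed compact_continuous_image continuous_intros)
  \<comment> \<open>The minimum defining \<open>f x\<close> is attained, so
    \<open>f x \<le> a\<close> is witnessed by a feasible pair of cost at most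
    \<open>a\<close>.\<close>
  moreover have "{x\<in>X. f x \<le> a} = fst ` W'"
  proof (intro equalityI subsetI)
    fix x assume x: "x \<in> {x\<in>X. f x \<le> a}"
    then have "f x \<in> recourse_values J l L Y Z x"
      using assms(1) unfolding complete_continuous_recourse_def by blast
    then obtain y z where "f x = l (y + z)" "L (x, y + z) \<le> 0" "y \<in> Y \<inter> integral_on J" "z \<in> Z"
      unfolding recourse_values_def by blast
    then have "(x, y, z) \<in> W'" using x unfolding W'_def W_def by auto
    then show "x \<in> fst ` W'" by force
  next
    fix x assume "x \<in> fst ` W'"
    then obtain y z where *: "x \<in> X" "y \<in> Y \<inter> integral_on J" "z \<in> Z" "L (x, y + z) \<le> 0" "l (y + z) \<le> a"
      unfolding W'_def W_def by auto
    then have "l (y + z) \<in> recourse_values J l L Y Z x" unfolding recourse_values_def by blast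
    then have "f x \<le> l (y + z)" using assms(1) * unfolding complete_continuous_recourse_def by blast
    then show "x \<in> {x\<in>X. f x \<le> a}" using * by auto
  qed
  ultimately have "open (- {x\<in>X. f x \<le> a})" by (simp add: open_Compl)
  then have "openin (top_of_set X) (X \<inter> - {x\<in>X. f x \<le> a})" by (rule openin_open_Int)
  also have "X \<inter> - {x\<in>X. f x \<le> a} = {x\<in>X. a < f x}" by auto
  finally show "openin (top_of_set X) {x\<in>X. a < f x}" .
qed

lemma complete_continuous_recourse_lsc:
  assumes "complete_continuous_recourse J X f l L Y Z" "compact X"
  shows "lsc_on X f"
proof -
  consider "affine_recourse J X l L Y Z" | "convex_recourse J X l L Y Z"
    using assms(1) unfolding complete_continuous_recourse_def by blast
  then show ?thesis
  proof cases
    case 1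
    obtain M where "M-lipschitz_on X f" by (rule affine_recourse_lipschitz[OF assms(1) 1])
    then show ?thesis by (intro lsc_on_continuous lipschitz_on_continuous_on)
  next
    case 2
    then show ?thesis by (intro convex_recourse_lsc[OF assms(1) _ assms(2)])
  qed
qed

section \<open>Near returns in compact sets\<close>

text \<open>
  Only a lower bound on \<open>a\<close> is needed: a monotone subsequence is either increasing, and then there is
  nothing to show, or decreasing and bounded, hence Cauchy.
\<close>

lemma ex_near_return:
  fixes u :: "nat \<Rightarrow> 'a::metric_space" and a :: "nat \<Rightarrow> real"
  assumes "compact X" "\<And>n. u n \<in> X" "\<And>n. m \<le> a n" "0 < e"
  obtains s t where "s < t" "dist (u s) (u t) < e" "a s - e < a t"
proof -
  obtain x r where r: "strict_mono (r :: nat \<Rightarrow> nat)" "(u \<circ> r) \<longlonglongrightarrow> x"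
    using assms(1,2) unfolding compact_def by metis
  \<comment> \<open>Passing to a further subsequence keeps the convergence of the points.\<close>
  obtain q where q: "strict_mono (q :: nat \<Rightarrow> nat)" "monoseq (\<lambda>n. a (r (q n)))"
    using seq_monosub[of "\<lambda>n. a (r n)"] by blast
  have rq: "strict_mono (r \<circ> q)" using r(1) q(1) by (rule strict_mono_o)
  have "Cauchy (u \<circ> r \<circ> q)"
    using LIMSEQ_subseq_LIMSEQ[OF r(2) q(1)] by (rule LIMSEQ_imp_Cauchy)
  then obtain n0 where n0: "\<And>i j. n0 \<le> i \<Longrightarrow> n0 \<le> j \<Longrightarrow> dist (u (r (q i))) (u (r (q j))) < e"
    using assms(4) unfolding Cauchy_def o_def by blast
  have "\<exists>n1. \<forall>i\<ge>n1. \<forall>j>i. a (r (q i)) - e < a (r (q j))"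
  proof (cases "incseq (\<lambda>n. a (r (q n)))")
    case True
    then have "a (r (q i)) - e < a (r (q j))" if "i < j" for i j
      using incseqD[OF True, of i j] that assms(4) by simp
    then show ?thesis by blast
  next
    case False
    then have "decseq (\<lambda>n. a (r (q n)))" using q(2) by (simp add: monoseq_iff)
    then have "Cauchy (\<lambda>n. a (r (q n)))"
      using decseq_convergent[of "\<lambda>n. a (r (q n))" m] assms(3)
      by (metis convergent_Cauchy convergentI)
    then obtain n1 where n1: "\<And>i j. n1 \<le> i \<Longrightarrow> n1 \<le> j \<Longrightarrow> dist (a (r (q i))) (a (r (q j))) < e"
      using assms(4) unfolding Cauchy_def by blast
    have "a (r (q i)) - e < a (r (q j))" if "n1 \<le> i" "i < j" for i j
      using n1[of i j] that by (simp add: dist_real_def abs_less_iff)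
    then show ?thesis by blast
  qed
  then obtain n1 where n1: "\<And>i j. n1 \<le> i \<Longrightarrow> i < j \<Longrightarrow> a (r (q i)) - e < a (r (q j))" by blast
  let ?i = "max n0 n1"
  show thesis
  proof (rule that[of "r (q ?i)" "r (q (Suc ?i))"])
    show "r (q ?i) < r (q (Suc ?i))" using strict_monoD[OF rq, of ?i "Suc ?i"] by simp
  qed (use n0 n1 in auto)
qed

section \<open>Convergence of the subproblem values\<close>

lemma gdd_points_eq: "gdd_points N xs t = {xs s i | s i. s < t \<and> i \<in> {1..N}}"
  by (induction t) (auto simp: less_Suc_eq)

lemma finite_gdd_points: "finite (gdd_points N xs t)"
proof (induction t)
  case (Suc t)
  have "{xs t i | i. i \<in> {1..N}} = xs t ` {1..N}" by auto
  then show ?case using Suc by simp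
qed simp

lemma regularizer_ge:
  assumes "finite P" "c \<in> P"
  shows "cutf c x \<le> regularizer cutf P x"
  using assms by (auto simp: regularizer_def)

lemma regularizer_le:
  assumes "finite P" "P \<noteq> {}" "\<And>c. c \<in> P \<Longrightarrow> cutf c x \<le> b"
  shows "regularizer cutf P x \<le> b"
  using assms by (auto simp: regularizer_def)

text \<open>The functions \<open>g_star N f i\<close> sum to zero over \<open>i\<close>:
  \<open>N\<close> copies of the average make up the sum.\<close>

lemma g_star_sum:
  assumes "N \<ge> 1"
  shows "(\<Sum>i = 1..N. f i x + g_star N f i x) = (\<Sum>i = 1..N. f i x)"
  using assms by (simp add: g_star_def)

text \<open>From iteration 1 on the value is increasing and at most the limit, so it suffices that
  it exceeds \<open>V - e\<close> once for each \<open>e > 0\<close>.\<close>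

lemma gdd_subproblem_tendsto:
  fixes X :: "'a::metric_space set"
  assumes "N \<ge> 1" "compact X" "i \<in> {1..N}"
    and bdd: "\<And>x. x \<in> X \<Longrightarrow> m \<le> f i x"
    and cuts: "valid_cuts X (g_star N f i) (cutf i)" "tight_cuts X (g_star N f i) (cutf i)"
      "uniformly_lipschitz_cuts X (cutf i)"
    and run: "gdd_run N X f cutf xs"
    and v: "x_star \<in> X" "\<And>x. x \<in> X \<Longrightarrow> (\<Sum>j = 1..N. f j x_star) \<le> (\<Sum>j = 1..N. f j x)"
  shows "(\<lambda>t. gdd_objective N f cutf xs t i (xs t i)) \<longlonglongrightarrow> (\<Sum>j = 1..N. f j x_star) / real N"
proof -
  define w where "w t = gdd_objective N f cutf xs t i (xs t i)" for t
  define V where "V = (\<Sum>j = 1..N. f j x_star) / real N"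
  have opt: "xs t j \<in> X" "x \<in> X \<Longrightarrow> gdd_objective N f cutf xs t j (xs t j) \<le> gdd_objective N f cutf xs t j x"
    if "j \<in> {1..N}" for t j x
    using run that unfolding gdd_run_def is_arg_min_linorder by auto
  have sub: "gdd_points N xs t \<subseteq> X" for t unfolding gdd_points_eq using opt(1) by auto
  have ne: "gdd_points N xs t \<noteq> {}" if "0 < t" for t
    unfolding gdd_points_eq using that assms(3) by auto
  \<comment> \<open>At \<open>x_star\<close>, validity bounds the regularizer by
    \<open>g_star N f i\<close>, and adding \<open>f i\<close> to the latter yields the average
    \<open>V\<close>.\<close>
  have upper: "w t \<le> V" if "0 < t" for t
  proof -
    have "regularizer (cutf i) (gdd_points N xs t) x_star \<le> g_star N f i x_star"
      using cuts(1) v(1) sub ne[OF that]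
      by (intro regularizer_le finite_gdd_points) (auto simp: valid_cuts_def)
    moreover have "w t \<le> gdd_objective N f cutf xs t i x_star" unfolding w_def using opt(2) assms(3) v(1) by blast
    ultimately show ?thesis unfolding gdd_objective_def V_def g_star_def by linarith
  qed
  \<comment> \<open>More points give a larger maximum. Iteration 0 is excluded: its regularizer is
    the default 0, which later cuts may undercut.\<close>
  have mono: "w s \<le> w t" if "0 < s" "s \<le> t" for s t
  proof -
    have "gdd_points N xs s \<subseteq> gdd_points N xs t" unfolding gdd_points_eq using that by force
    then have "regularizer (cutf i) (gdd_points N xs s) (xs t i) \<le> regularizer (cutf i) (gdd_points N xs t) (xs t i)"
      using ne[OF that(1)] finite_gdd_points by (intro regularizer_le regularizer_ge) auto
    moreover have "w s \<le> gdd_objective N f cutf xs s i (xs t i)"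
      unfolding w_def using opt assms(3) by blast
    ultimately show ?thesis unfolding w_def gdd_objective_def by linarith
  qed
  obtain C where C: "\<And>c. c \<in> X \<Longrightarrow> C-lipschitz_on X (cutf i c)"
    using cuts(3) unfolding uniformly_lipschitz_cuts_def by blast
  then have "0 \<le> C" using v(1) lipschitz_on_nonneg by blast
  \<comment> \<open>the cut generated at an earlier, nearby point is almost tight at the current one\<close>
  have lower: "\<exists>t>0. V - e < w t" if "0 < e" for e
  proof -
    \<comment> \<open>The Lipschitz error \<open>C * d\<close> of the cut and the drop
      \<open>d\<close> of \<open>f i\<close> add up to \<open>e\<close>; the denominator is positive
      even for \<open>C = 0\<close>.\<close>
    define d where "d = e / (C + 1)"
    have d: "0 < d" "(C + 1) * d = e" using \<open>0 \<le> C\<close> that by (auto simp: d_def)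
    obtain s t where st: "s < t" "dist (xs s i) (xs t i) < d" "f i (xs s i) - d < f i (xs t i)"
      using ex_near_return[OF assms(2), of "\<lambda>t. xs t i" m "\<lambda>t. f i (xs t i)" d] opt(1) bdd assms(3) d(1)
      by metis
    let ?c = "xs s i" and ?x = "xs t i"
    have mem: "?c \<in> X" "?x \<in> X" using opt(1) assms(3) by auto
    have "?c \<in> gdd_points N xs t" unfolding gdd_points_eq using st(1) assms(3) by blast
    then have "cutf i ?c ?x \<le> regularizer (cutf i) (gdd_points N xs t) ?x"
      by (intro regularizer_ge finite_gdd_points)
    moreover have "cutf i ?c ?c - C * d \<le> cutf i ?c ?x"
    proof -
      have "dist (cutf i ?c ?c) (cutf i ?c ?x) \<le> C * dist ?c ?x"
        using lipschitz_onD[OF C[OF mem(1)]] mem by blast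
      also have "\<dots> \<le> C * d" using st(2) \<open>0 \<le> C\<close> by (intro mult_left_mono) auto
      finally show ?thesis by (auto simp: dist_real_def abs_le_iff)
    qed
    \<comment> \<open>The term \<open>- f i ?c\<close> from tightness cancels against the lower
      bound \<open>f i ?c - d\<close> for \<open>f i ?x\<close>, leaving the average at
      \<open>?c\<close>, which is at least \<open>V\<close>.\<close>
    moreover have "cutf i ?c ?c = (\<Sum>j = 1..N. f j ?c) / real N - f i ?c"
      using cuts(2) mem(1) unfolding tight_cuts_def g_star_def by auto
    moreover have "V \<le> (\<Sum>j = 1..N. f j ?c) / real N"
      unfolding V_def using v(2)[OF mem(1)] by (intro divide_right_mono) auto
    moreover have "C * d + d = e" using d(2) by (simp add: algebra_simps)
    ultimately have "V - e < w t" unfolding w_def gdd_objective_def using st(3) by linarith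
    then show ?thesis using st(1) by (intro exI[of _ t]) auto
  qed
  have "w \<longlonglongrightarrow> V"
  proof (rule LIMSEQ_I)
    fix e :: real assume "0 < e"
    then obtain t where t: "0 < t" "V - e < w t" using lower by blast
    have "norm (w s - V) < e" if "t \<le> s" for s
      using mono[OF t(1) that] upper[of s] t that \<open>0 < e\<close> by (simp add: abs_less_iff)
    then show "\<exists>n0. \<forall>n\<ge>n0. norm (w n - V) < e" by blast
  qed
  then show ?thesis unfolding w_def V_def .
qed

section \<open>Convergence of the lower bounds\<close>

lemma gdd_lb_ge: "(\<Sum>i = 1..N. gdd_objective N f cutf xs t i (xs t i)) \<le> gdd_lb N f cutf xs t"
  by (cases t) auto

text \<open>Comparing each subproblem with the feasible point \<open>x\<close> and using validity
  replaces the regularizers by the \<open>g_star N f i\<close>, whose sum vanishes.\<close>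

lemma gdd_lb_le:
  assumes "N \<ge> 1" "\<forall>i\<in>{1..N}. valid_cuts X (g_star N f i) (cutf i)" "gdd_run N X f cutf xs" "x \<in> X"
  shows "gdd_lb N f cutf xs t \<le> (\<Sum>i = 1..N. f i x)"
proof -
  have opt: "xs t i \<in> X" "gdd_objective N f cutf xs t i (xs t i) \<le> gdd_objective N f cutf xs t i x"
    if "i \<in> {1..N}" for t i
    using assms(3,4) that unfolding gdd_run_def is_arg_min_linorder by auto
  have "(\<Sum>i = 1..N. gdd_objective N f cutf xs t i (xs t i)) \<le> (\<Sum>i = 1..N. f i x)" for t
  proof (cases "t = 0")
    \<comment> \<open>Before any cut exists the objectives are the \<open>f i\<close> themselves, so
      validity is not what gives the bound here.\<close>
    case True
    have "(\<Sum>i = 1..N. gdd_objective N f cutf xs t i (xs t i)) \<le> (\<Sum>i = 1..N. gdd_objective N f cutf xs t i x)"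
      using opt(2) by (rule sum_mono)
    then show ?thesis using True by (simp add: gdd_objective_def regularizer_def)
  next
    case False
    have "(\<Sum>i = 1..N. gdd_objective N f cutf xs t i (xs t i)) \<le> (\<Sum>i = 1..N. f i x + g_star N f i x)"
    proof (rule sum_mono)
      fix i assume i: "i \<in> {1..N}"
      have "gdd_points N xs t \<subseteq> X" unfolding gdd_points_eq using opt(1) by auto
      moreover have "gdd_points N xs t \<noteq> {}" unfolding gdd_points_eq using False i by auto
      ultimately have "regularizer (cutf i) (gdd_points N xs t) x \<le> g_star N f i x"
        using assms(2,4) i by (intro regularizer_le finite_gdd_points) (auto simp: valid_cuts_def)
      then show "gdd_objective N f cutf xs t i (xs t i) \<le> f i x + g_star N f i x"
        using opt(2)[OF i, of t] unfolding gdd_objective_def by linarith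
    qed
    then show ?thesis by (simp only: g_star_sum[OF assms(1)])
  qed
  then show ?thesis by (induction t) auto
qed

theorem theorem4:
  fixes N :: nat
    and J1 :: "'n::finite set"
    and X :: "(real ^ 'n) set"
    and f :: "nat \<Rightarrow> real ^ 'n \<Rightarrow> real"
    and J2 :: "'m::finite set"
    and l :: "nat \<Rightarrow> real ^ 'm \<Rightarrow> real"
    and L :: "nat \<Rightarrow> (real ^ 'n) \<times> (real ^ 'm) \<Rightarrow> real ^ 'k::finite"
    and Y Z :: "nat \<Rightarrow> (real ^ 'm) set"
    and cutf :: "nat \<Rightarrow> real ^ 'n \<Rightarrow> real ^ 'n \<Rightarrow> real"
    and xs :: "nat \<Rightarrow> nat \<Rightarrow> real ^ 'n"
  assumes "N \<ge> 1"
    and "X \<subseteq> integral_on J1" and "X \<noteq> {}" and "compact X"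
    and "\<forall>i\<in>{1..N}. complete_continuous_recourse J2 X (f i) (l i) (L i) (Y i) (Z i)"
    and "\<forall>i\<in>{1..N}. valid_cuts X (g_star N f i) (cutf i)"
    and "\<forall>i\<in>{1..N}. tight_cuts X (g_star N f i) (cutf i)"
    and "\<forall>i\<in>{1..N}. uniformly_lipschitz_cuts X (cutf i)"
    and "gdd_run N X f cutf xs"
  shows "\<exists>x_star. is_arg_min (\<lambda>x. \<Sum>i = 1..N. f i x) (\<lambda>x. x \<in> X) x_star \<and>
           gdd_lb N f cutf xs \<longlonglongrightarrow> (\<Sum>i = 1..N. f i x_star)"
proof -
  have lsc: "lsc_on X (f i)" if "i \<in> {1..N}" for i
    using complete_continuous_recourse_lsc assms(4,5) that by blast
  then have "lsc_on X (\<lambda>x. \<Sum>i = 1..N. f i x)" by (rule lsc_on_sum)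
  from lsc_on_attains_inf[OF this assms(4,3)]
  obtain x_star where x_star: "x_star \<in> X"
    "\<And>x. x \<in> X \<Longrightarrow> (\<Sum>i = 1..N. f i x_star) \<le> (\<Sum>i = 1..N. f i x)" by auto
  have "(\<lambda>t. gdd_objective N f cutf xs t i (xs t i)) \<longlonglongrightarrow> (\<Sum>j = 1..N. f j x_star) / real N"
    if "i \<in> {1..N}" for i
  proof -
    \<comment> \<open>The minimum of \<open>f i\<close> over \<open>X\<close> supplies the lower
      bound needed for near returns.\<close>
    from lsc_on_attains_inf[OF lsc[OF that] assms(4,3)]
    obtain x0 where "\<And>x. x \<in> X \<Longrightarrow> f i x0 \<le> f i x" by auto
    then show ?thesis
      using assms(6-8) that x_star
      by (intro gdd_subproblem_tendsto[OF assms(1,4) that _ _ _ _ assms(9)]) auto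
  qed
  then have "(\<lambda>t. \<Sum>i = 1..N. gdd_objective N f cutf xs t i (xs t i)) \<longlonglongrightarrow>
      (\<Sum>i = 1..N. (\<Sum>j = 1..N. f j x_star) / real N)"
    by (rule tendsto_sum)
  then have "(\<lambda>t. \<Sum>i = 1..N. gdd_objective N f cutf xs t i (xs t i)) \<longlonglongrightarrow> (\<Sum>i = 1..N. f i x_star)"
    using assms(1) by simp
  \<comment> \<open>The running maximum lies between the current sum of subproblem values and the
    optimal value.\<close>
  then have "gdd_lb N f cutf xs \<longlonglongrightarrow> (\<Sum>i = 1..N. f i x_star)"
    by (rule tendsto_sandwich[OF always_eventually always_eventually _ tendsto_const, rotated 2])
      (use gdd_lb_ge gdd_lb_le[OF assms(1,6,9) x_star(1)] in blast)+
  moreover have "is_arg_min (\<lambda>x. \<Sum>i = 1..N. f i x) (\<lambda>x. x \<in> X) x_star"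
    using x_star by (simp add: is_arg_min_linorder)
  ultimately show ?thesis by blast
qed

end
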